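(* Let $G$ and $H$ be two connected non-trivial finite simple graphs such that $\max\{a'(G),a'(H)\} > 1$. Then $$a'(G \Box H) \leq a'(G)+a'(H).$$
   Context: All graphs are finite and simple. A graph is non-trivial if it has at least two vertices. A proper edge colouring of a graph is an assignment of colours to its edges such that no two edges sharing an endpoint receive the same colour. A proper edge colouring is acyclic if there is no cycle whose edges use only two colours (equivalently, the union of any two colour classes is a forest). The acyclic chromatic index $a'(G)$ is the minimum number of colours in an acyclic proper edge colouring of $G$. The cartesian product $G \Box H$ of $G=(V_G,E_G)$ and $H=(V_H,E_H)$ has vertex set $V_G\times V_H$, and $(u_1,v_1)$ is adjacent to $(u_2,v_2)$ if and only if either $u_1=u_2$ and $\{v_1,v_2\}\in E_H$, or $v_1=v_2$ and $\{u_1,u_2\}\in E_G$. *)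

theory Defs
  imports
    "Graph_Theory.Pair_Digraph"
    "Graph_Theory.Digraph_Component"
begin

text \<open>
  A finite simple graph is a \<^locale>\<open>pair_graph\<close>: a finite, loopless, symmetric relation on a finite
  vertex set. An undirected edge is thus a pair of opposite arcs; colours are given to the unordered
  edges so that both arcs share one colour.
\<close>

definition graph_edges :: "'a pair_pre_digraph \<Rightarrow> 'a set set" where
  "graph_edges G = {{u, v} | u v. (u, v) \<in> parcs G}"

definition proper_edge_colouring :: "'a pair_pre_digraph \<Rightarrow> ('a set \<Rightarrow> 'c) \<Rightarrow> bool" where
  "proper_edge_colouring G c \<longleftrightarrow>
    (\<forall>e \<in> graph_edges G. \<forall>f \<in> graph_edges G. e \<noteq> f \<and> e \<inter> f \<noteq> {} \<longrightarrow> c e \<noteq> c f)"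

text \<open>
  The library predicate \<^const>\<open>pre_digraph.cycle\<close> also accepts the closed walk formed by the two arcs
  of a single edge. The undirected cycles of a simple graph are those of length at least three.
\<close>

definition graph_cycle :: "'a pair_pre_digraph \<Rightarrow> ('a \<times> 'a) list \<Rightarrow> bool" where
  "graph_cycle G p \<longleftrightarrow> pre_digraph.cycle (with_proj G) p \<and> 3 \<le> length p"

definition acyclic_edge_colouring :: "'a pair_pre_digraph \<Rightarrow> ('a set \<Rightarrow> 'c) \<Rightarrow> bool" where
  "acyclic_edge_colouring G c \<longleftrightarrow> proper_edge_colouring G c \<and>
    \<not> (\<exists>p. graph_cycle G p \<and> card ((\<lambda>(u, v). c {u, v}) ` set p) \<le> 2)"

definition acyclic_chromatic_index :: "'a pair_pre_digraph \<Rightarrow> nat" where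
  "acyclic_chromatic_index G =
    (LEAST k. \<exists>c :: 'a set \<Rightarrow> nat. acyclic_edge_colouring G c \<and> card (c ` graph_edges G) = k)"

definition cartesian_product ::
    "'a pair_pre_digraph \<Rightarrow> 'b pair_pre_digraph \<Rightarrow> ('a \<times> 'b) pair_pre_digraph"
    (infixl \<open>\<box>\<close> 70) where
  "G \<box> H = \<lparr> pverts = pverts G \<times> pverts H,
     parcs = {((u1, v1), (u2, v2)) | u1 v1 u2 v2.
       (u1 = u2 \<and> u1 \<in> pverts G \<and> (v1, v2) \<in> parcs H) \<or>
       (v1 = v2 \<and> v1 \<in> pverts H \<and> (u1, u2) \<in> parcs G)} \<rparr>"

lemma pair_graph_cartesian_product:
  assumes "pair_graph G" "pair_graph H"
  shows "pair_graph (G \<box> H)"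
proof -
  interpret G: pair_graph G by fact
  interpret H: pair_graph H by fact
  have sub: "parcs (G \<box> H) \<subseteq> (pverts G \<times> pverts H) \<times> (pverts G \<times> pverts H)"
    by (auto simp: cartesian_product_def dest: G.in_arcsD1 G.in_arcsD2 H.in_arcsD1 H.in_arcsD2)
  show ?thesis
  proof
    show "fst e \<in> pverts (G \<box> H)" "snd e \<in> pverts (G \<box> H)" if "e \<in> parcs (G \<box> H)" for e
      using that by (auto simp: cartesian_product_def
          dest: G.in_arcsD1 G.in_arcsD2 H.in_arcsD1 H.in_arcsD2)
    show "finite (pverts (G \<box> H))"
      by (simp add: cartesian_product_def G.pair_finite_verts H.pair_finite_verts)
    show "finite (parcs (G \<box> H))"
      by (rule finite_subset[OF sub])
         (simp add: G.pair_finite_verts H.pair_finite_verts)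
    show "fst e \<noteq> snd e" if "e \<in> parcs (G \<box> H)" for e
      using that by (auto simp: cartesian_product_def dest: G.no_loops' H.no_loops')
    show "symmetric (with_proj (G \<box> H))"
      by (auto simp: symmetric_def sym_def cartesian_product_def
          intro: G.arcs_symmetric H.arcs_symmetric)
  qed
qed

text \<open>
  The minimum in \<^const>\<open>acyclic_chromatic_index\<close> is over a nonempty set: giving all edges distinct
  colours works.
\<close>

lemma ex_acyclic_edge_colouring:
  assumes "pair_graph G"
  shows "\<exists>c :: 'a set \<Rightarrow> nat. acyclic_edge_colouring (G :: 'a pair_pre_digraph) c"
proof -
  interpret G: pair_graph G by fact
  have "graph_edges G = (\<lambda>(u, v). {u, v}) ` parcs G"
    by (auto simp: graph_edges_def)
  then have "finite (graph_edges G)"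
    using G.pair_finite_arcs by simp
  then obtain c :: "'a set \<Rightarrow> nat" where c: "inj_on c (graph_edges G)"
    using finite_imp_inj_to_nat_seg by blast
  have "2 < card ((\<lambda>(u, v). c {u, v}) ` set p)" if "graph_cycle G p" for p
  proof -
    from that obtain u where w: "G.awalk u p u" and d: "distinct (tl (pawalk_verts u p))"
      and len: "3 \<le> length p"
      unfolding graph_cycle_def G.cycle_def by blast
    from len obtain a1 a2 a3 p' where p: "p = a1 # a2 # a3 # p'"
      by (metis (no_types, opaque_lifting) One_nat_def Suc_le_length_iff numeral_3_eq_3)
    obtain x y z where a: "a1 = (u, x)" "a2 = (x, y)" "a3 = (y, z)"
      using w p by (cases a1; cases a2; cases a3) (auto simp: G.awalk_Cons_iff)
    have arcs: "(u, x) \<in> parcs G" "(x, y) \<in> parcs G" "(y, z) \<in> parcs G"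
      using w by (auto simp: p a G.awalk_Cons_iff)
    have w': "G.awalk z p' u"
      using w by (auto simp: p a G.awalk_Cons_iff)
    have mem: "u \<in> set (pawalk_verts z p')"
      using w' by (metis G.awalk_verts_non_Nil G.awlast_if_cas G.awalk_def last_in_set)
    have zmem: "z \<in> set (pawalk_verts z p')"
      by (cases p') (use w' in \<open>auto simp: G.awalk_Cons_iff\<close>)
    have ne: "x \<noteq> y" "x \<noteq> z" "y \<noteq> z" "u \<noteq> x" "u \<noteq> y"
      using d mem zmem by (auto simp: p a)
    have "{c {u, x}, c {x, y}, c {y, z}} \<subseteq> (\<lambda>(u, v). c {u, v}) ` set p"
      by (auto simp: p a)
    moreover have "card {c {u, x}, c {x, y}, c {y, z}} = 3"
    proof -
      have e: "{u, x} \<in> graph_edges G" "{x, y} \<in> graph_edges G" "{y, z} \<in> graph_edges G"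
        using arcs by (auto simp: graph_edges_def)
      have "c {u, x} \<noteq> c {x, y}" "c {u, x} \<noteq> c {y, z}" "c {x, y} \<noteq> c {y, z}"
        using ne e by (auto simp: inj_on_eq_iff[OF c] doubleton_eq_iff)
      then show ?thesis by simp
    qed
    ultimately show ?thesis
      by (metis List.finite_set card_mono finite_imageI numeral_2_eq_2 numeral_3_eq_3 Suc_le_eq)
  qed
  moreover have "proper_edge_colouring G c"
    using c by (auto simp: proper_edge_colouring_def inj_on_def)
  ultimately have "acyclic_edge_colouring G c"
    unfolding acyclic_edge_colouring_def by (meson not_le)
  then show ?thesis by blast
qed

end

theory Submission
  imports Defs "HOL-Number_Theory.Cong"
begin

text \<open>
  By symmetry let \<open>a = a'(G) \<ge> a'(H)\<close>, so \<open>a \<ge> 2\<close>. Every vertex of \<open>H\<close> has degree at most \<open>a\<close>, and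
  some vertex has smaller degree, since otherwise all colours would occur at every vertex and two of
  them would form a cycle. As \<open>H\<close> is connected, greedy colouring yields a proper vertex colouring
  \<open>f\<close> of \<open>H\<close> with \<open>a\<close> colours. Colour the copy of \<open>G\<close> at \<open>v\<close> by the colouring of \<open>G\<close> shifted
  cyclically by \<open>f v\<close>, and all copies of \<open>H\<close> alike with new colours. A cycle using one shifted and one
  new colour alternates between two adjacent copies of \<open>G\<close>, whose shifts differ, so its projection to
  \<open>G\<close> alternates between two colours of \<open>G\<close>, which is impossible.
\<close>

section \<open>Two-coloured cycles as alternating walks\<close>

text \<open>
  In a finite graph, two-coloured cycles and infinite alternating walks imply each other. The latter
  need no distinctness of vertices and therefore survive projection to a factor.
\<close>

definition alternating_walk ::
    "'a pair_pre_digraph \<Rightarrow> ('a set \<Rightarrow> 'c) \<Rightarrow> 'c \<Rightarrow> 'c \<Rightarrow> (nat \<Rightarrow> 'a) \<Rightarrow> bool" where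
  "alternating_walk G c p q x \<longleftrightarrow>
    (\<forall>i. (x i, x (Suc i)) \<in> parcs G \<and> c {x i, x (Suc i)} = (if even i then p else q))"

lemma alternating_walk_shift:
  assumes "alternating_walk G c p q x"
  shows "alternating_walk G c q p (\<lambda>i. x (Suc i))"
  using assms by (auto simp: alternating_walk_def)

text \<open>By symmetry of the arcs an edge can be written with either endpoint first, so two
  intersecting edges become two arcs leaving one vertex, the form that occurs along walks.\<close>

lemma (in pair_graph) proper_edge_colouring_iff:
  "proper_edge_colouring G c \<longleftrightarrow>
    (\<forall>u v w. (u, v) \<in> parcs G \<longrightarrow> (u, w) \<in> parcs G \<longrightarrow> v \<noteq> w \<longrightarrow> c {u, v} \<noteq> c {u, w})"
  (is "_ \<longleftrightarrow> ?P")
proof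
  assume proper: "proper_edge_colouring G c"
  show ?P
  proof (intro allI impI)
    fix u v w assume "(u, v) \<in> parcs G" "(u, w) \<in> parcs G" "v \<noteq> w"
    then have "{u, v} \<in> graph_edges G" "{u, w} \<in> graph_edges G" "{u, v} \<noteq> {u, w}"
      by (auto simp: graph_edges_def doubleton_eq_iff)
    then show "c {u, v} \<noteq> c {u, w}"
      using proper[unfolded proper_edge_colouring_def, rule_format, of "{u, v}" "{u, w}"] by simp
  qed
next
  assume P: ?P
  have star: "\<exists>v. e = {u, v} \<and> (u, v) \<in> parcs G" if e: "e \<in> graph_edges G" "u \<in> e" for e u
  proof -
    obtain a b where "e = {a, b}" "(a, b) \<in> parcs G"
      using e(1) by (auto simp: graph_edges_def)
    moreover from this have "(b, a) \<in> parcs G"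
      by (simp add: arcs_symmetric)
    ultimately show ?thesis
      using e(2) by auto
  qed
  show "proper_edge_colouring G c"
    unfolding proper_edge_colouring_def
  proof (intro ballI impI)
    fix e f assume ef: "e \<in> graph_edges G" "f \<in> graph_edges G" "e \<noteq> f \<and> e \<inter> f \<noteq> {}"
    then obtain u where "u \<in> e" "u \<in> f" by blast
    with ef star obtain v w where "e = {u, v}" "f = {u, w}" "(u, v) \<in> parcs G" "(u, w) \<in> parcs G"
      by metis
    then show "c e \<noteq> c f" using P ef(3) by auto
  qed
qed

text \<open>Access by index serves to turn a cycle into a periodic sequence, where the last arc has
  to be matched with the first.\<close>

lemma (in pair_graph) nth_awalk:
  assumes "awalk u p v" "i < length p"
  shows "p ! i \<in> parcs G \<and> fst (p ! i) = (if i = 0 then u else snd (p ! (i - 1)))"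
  using assms
proof (induction p arbitrary: u i)
  case (Cons e p)
  then have e: "e \<in> parcs G" "fst e = u" "awalk (snd e) p v"
    by (auto simp: awalk_Cons_iff)
  show ?case
  proof (cases i)
    case (Suc j)
    then show ?thesis
      using Cons.IH[OF e(3), of j] Cons.prems(2) by (cases j) auto
  qed (use e in simp)
qed simp

lemma (in pair_graph) awalk_of_sequence:
  assumes "\<And>k. (x k, x (Suc k)) \<in> parcs G"
  shows "awalk (x i) (map (\<lambda>k. (x k, x (Suc k))) [i..<i + d]) (x (i + d))"
proof (induction d arbitrary: i)
  case 0
  then show ?case
    using assms in_arcsD1 by (auto simp: awalk_Nil_iff)
next
  case (Suc d)
  have "[i..<i + Suc d] = i # [Suc i..<Suc i + d]"
    by (simp add: upt_rec)
  then show ?case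
    using Suc[of "Suc i"] assms by (simp add: awalk_Cons_iff)
qed

text \<open>Turns the distinctness condition of \<open>cycle\<close> into one on the heads of the
  arcs.\<close>

lemma (in pair_graph) map_snd_eq_tl_awalk_verts:
  assumes "awalk u p v"
  shows "tl (pawalk_verts u p) = map snd p"
  using assms by (auto simp: awalk_def awalk_verts_conv'[of u p v])

text \<open>An infinite walk in a finite graph revisits a vertex, and a shortest return along it is
  a cycle. Conversely, a cycle is traversed periodically; properness and at most two colours force
  alternation.\<close>

lemma (in pair_graph) acyclic_edge_colouring_iff:
  "acyclic_edge_colouring G c \<longleftrightarrow> proper_edge_colouring G c \<and>
    \<not> (\<exists>p q x. p \<noteq> q \<and> alternating_walk G c p q x)"
proof -
  have "\<exists>p. graph_cycle G p \<and> card ((\<lambda>(u, v). c {u, v}) ` set p) \<le> 2"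
    if pq: "p \<noteq> q" and x: "alternating_walk G c p q x" for p q x
  proof -
    have arc: "(x i, x (Suc i)) \<in> parcs G" for i
      using x by (simp add: alternating_walk_def)
    have col: "c {x i, x (Suc i)} = (if even i then p else q)" for i
      using x by (simp add: alternating_walk_def)
    have "range x \<subseteq> pverts G" using arc in_arcsD1 by blast
    then have "finite (range x)" using pair_finite_verts finite_subset by blast
    then have "\<not> inj x" using finite_imageD by blast
    then obtain i j where "i < j" "x i = x j"
      by (metis injI linorder_neqE_nat)
    \<comment> \<open>The gap \<open>d\<close> is minimised over all starting positions, so a
      repetition inside a window of length \<open>d\<close> would be a shorter return.\<close>
    then have "\<exists>d. 0 < d \<and> (\<exists>i. x i = x (i + d))"
      by (intro exI[of _ "j - i"] conjI exI[of _ i]) auto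
    then obtain d where d: "0 < d" "\<exists>i. x i = x (i + d)"
      and least: "\<And>e. \<lbrakk>0 < e; \<exists>i. x i = x (i + e)\<rbrakk> \<Longrightarrow> d \<le> e"
      using exists_least_iff[of "\<lambda>d. 0 < d \<and> (\<exists>i. x i = x (i + d))"] by (metis not_le)
    obtain i where i: "x i = x (i + d)" using d(2) by blast
    let ?w = "map (\<lambda>k. (x k, x (Suc k))) [i..<i + d]"
    have walk: "awalk (x i) ?w (x i)"
      using awalk_of_sequence[of x i d] arc i by simp
    have neq: "x (Suc k) \<noteq> x (Suc l)" if "i \<le> k" "k < l" "l < i + d" for k l
    proof
      assume "x (Suc k) = x (Suc l)"
      then have "x (Suc k) = x (Suc k + (l - k))" using that by simp
      then have "d \<le> l - k" using least that by (metis zero_less_diff)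
      then show False using that by simp
    qed
    have "inj_on (\<lambda>k. x (Suc k)) {i..<i + d}"
      by (rule linorder_inj_onI) (use neq in auto)
    then have dist: "distinct (tl (pawalk_verts (x i) ?w))"
      using map_snd_eq_tl_awalk_verts[OF walk] by (simp add: distinct_map comp_def)
    have "d \<noteq> 1" using i no_loops'[OF arc[of i]] by auto
    \<comment> \<open>With \<open>d = 2\<close> two consecutive arcs traverse one edge, whose colour
      would be both \<open>p\<close> and \<open>q\<close>.\<close>
    moreover have "d \<noteq> 2"
    proof
      assume "d = 2"
      with i have "{x i, x (Suc i)} = {x (Suc i), x (Suc (Suc i))}" by auto
      with col[of i] col[of "Suc i"] pq show False by (auto split: if_splits)
    qed
    ultimately have len: "3 \<le> length ?w" using d(1) by simp
    then have "?w \<noteq> []" by auto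
    with walk dist len have "graph_cycle G ?w"
      unfolding graph_cycle_def cycle_def by blast
    moreover have "(\<lambda>(u, v). c {u, v}) ` set ?w \<subseteq> {p, q}"
      using col by auto
    from card_mono[OF _ this] have "card ((\<lambda>(u, v). c {u, v}) ` set ?w) \<le> 2"
      using pq by simp
    ultimately show ?thesis by blast
  qed
  moreover have "\<exists>p q x. p \<noteq> q \<and> alternating_walk G c p q x"
    if proper: "proper_edge_colouring G c" and cyc: "graph_cycle G w"
      and card: "card ((\<lambda>(u, v). c {u, v}) ` set w) \<le> 2" for w
  proof -
    obtain u where walk: "awalk u w u" and dist: "distinct (map snd w)" and len: "3 \<le> length w"
      using cyc map_snd_eq_tl_awalk_verts unfolding graph_cycle_def cycle_def by metis
    define n where "n = length w"
    \<comment> \<open>With heads of arcs as vertices, the arc at position \<open>Suc i mod n\<close>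
      runs from \<open>x i\<close> to \<open>x (Suc i)\<close>, and \<open>dist\<close> applies
      directly.\<close>
    define x where "x i = snd (w ! (i mod n))" for i
    have n: "3 \<le> n" using len n_def by simp
    have "w \<noteq> []" using len by auto
    then have lt: "i mod n < length w" for i
      using n_def by simp
    have last: "snd (w ! (n - 1)) = u"
      using walk \<open>w \<noteq> []\<close> n_def awlast_if_cas[of u w u] by (simp add: awalk_def awalk_verts_conv last_conv_nth)
    have arc: "w ! (Suc i mod n) = (x i, x (Suc i))" for i
    proof -
      have "fst (w ! (Suc i mod n)) = snd (w ! (i mod n))"
      proof (cases "Suc (i mod n) = n")
        case True
        then have "i mod n = n - 1" by simp
        then show ?thesis
          using nth_awalk[OF walk, of 0] True last \<open>w \<noteq> []\<close> n_def by (simp add: mod_Suc)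
      next
        case False
        moreover have "i mod n < n" using n by simp
        ultimately have "Suc (i mod n) < n" by simp
        then show ?thesis
          using nth_awalk[OF walk, of "Suc (i mod n)"] False n_def by (simp add: mod_Suc)
      qed
      then show ?thesis by (simp add: x_def prod_eq_iff)
    qed
    have mem: "w ! (i mod n) \<in> set w" for i
      using lt by (intro nth_mem)
    have arcs: "(x i, x (Suc i)) \<in> parcs G" for i
      using mem[of "Suc i"] arc[of i] walk by (auto simp: awalk_def)
    let ?c = "\<lambda>i. c {x i, x (Suc i)}"
    have col: "?c i \<in> (\<lambda>(u, v). c {u, v}) ` set w" for i
      using mem[of "Suc i"] arc[of i] by force
    \<comment> \<open>Since \<open>3 \<le> n\<close>, positions \<open>i\<close> and
      \<open>i + 2\<close> differ modulo \<open>n\<close>; hence consecutive arcs lie on different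
      edges at a common vertex.\<close>
    have skip: "x i \<noteq> x (Suc (Suc i))" for i
    proof -
      have "i mod n \<noteq> Suc (Suc i) mod n" using n by (auto simp: mod_Suc)
      then show ?thesis
        using nth_eq_iff_index_eq[OF dist, of "i mod n" "Suc (Suc i) mod n"] lt
        by (simp add: x_def)
    qed
    have ne: "?c i \<noteq> ?c (Suc i)" for i
      using proper[unfolded proper_edge_colouring_iff, rule_format,
          OF arcs_symmetric[OF arcs[of i]] arcs[of "Suc i"] skip]
      by (simp add: insert_commute)
    \<comment> \<open>Two consecutive arcs have different colours, which exhaust the at most two
      colours of the cycle.\<close>
    have "(\<lambda>(u, v). c {u, v}) ` set w = {?c 0, ?c 1}"
      using ne[of 0] col[of 0] col[of 1] card
      by (intro card_seteq[symmetric]) auto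
    then have two: "?c i \<in> {?c 0, ?c 1}" for i using col by blast
    have "?c i = (if even i then ?c 0 else ?c 1)" for i
    proof (induction i)
      case (Suc i)
      then show ?case using ne[of i] two[of "Suc i"] by auto
    qed simp
    then have "alternating_walk G c (?c 0) (?c 1) x"
      unfolding alternating_walk_def using arcs by blast
    then show ?thesis using ne[of 0] by auto
  qed
  ultimately show ?thesis unfolding acyclic_edge_colouring_def by blast
qed

section \<open>Colourings and the acyclic chromatic index\<close>

lemma (in pair_graph) finite_graph_edges: "finite (graph_edges G)"
proof -
  have "graph_edges G = (\<lambda>(u, v). {u, v}) ` parcs G"
    by (auto simp: graph_edges_def)
  then show ?thesis using pair_finite_arcs by simp
qed

lemma acyclic_chromatic_index_le:
  fixes c :: "'a set \<Rightarrow> nat"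
  assumes "acyclic_edge_colouring G c" "card (c ` graph_edges G) \<le> k"
  shows "acyclic_chromatic_index G \<le> k"
proof -
  have "acyclic_chromatic_index G \<le> card (c ` graph_edges G)"
    unfolding acyclic_chromatic_index_def using assms(1) by (intro Least_le) blast
  with assms(2) show ?thesis by simp
qed

lemma acyclic_chromatic_index_colouring:
  assumes "pair_graph G"
  obtains c :: "'a set \<Rightarrow> nat"
  where "acyclic_edge_colouring G c" "card (c ` graph_edges G) = acyclic_chromatic_index G"
proof -
  have "\<exists>k. \<exists>c :: 'a set \<Rightarrow> nat. acyclic_edge_colouring G c \<and> card (c ` graph_edges G) = k"
    using ex_acyclic_edge_colouring[OF assms] by blast
  from LeastI_ex[OF this] show ?thesis
    using that unfolding acyclic_chromatic_index_def by blast
qed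

text \<open>Serves to rename the colours of \<open>G\<close> to an initial segment. Injectivity
  preserves and reflects equality of used colours, so alternating walks pull back.\<close>

lemma (in pair_graph) acyclic_edge_colouring_comp:
  assumes "acyclic_edge_colouring G c" "inj_on g (c ` graph_edges G)"
  shows "acyclic_edge_colouring G (g \<circ> c)"
proof -
  have eq: "g (c e) = g (c f) \<longleftrightarrow> c e = c f"
    if "e \<in> graph_edges G" "f \<in> graph_edges G" for e f
    using assms(2) that by (auto simp: inj_on_def)
  have "\<exists>p q. p \<noteq> q \<and> alternating_walk G c p q x"
    if pq: "p \<noteq> q" and x: "alternating_walk G (g \<circ> c) p q x" for p q x
  proof -
    have arc: "(x i, x (Suc i)) \<in> parcs G" and e: "{x i, x (Suc i)} \<in> graph_edges G" for i
      using x by (auto simp: alternating_walk_def graph_edges_def)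
    have col: "g (c {x i, x (Suc i)}) = (if even i then p else q)" for i
      using x by (simp add: alternating_walk_def)
    have "c {x i, x (Suc i)} = (if even i then c {x 0, x 1} else c {x 1, x 2})" for i
      using eq[OF e[of i] e[of 0]] eq[OF e[of i] e[of 1]] col[of i] col[of 0] col[of 1]
      by (auto simp: numeral_2_eq_2)
    moreover have "c {x 0, x 1} \<noteq> c {x 1, x 2}"
      using col[of 0] col[of 1] pq by (auto simp: numeral_2_eq_2)
    ultimately show ?thesis
      using arc unfolding alternating_walk_def by blast
  qed
  moreover have "proper_edge_colouring G (g \<circ> c)"
    using assms(1) eq by (auto simp: acyclic_edge_colouring_iff proper_edge_colouring_def)
  ultimately show ?thesis
    using assms(1) unfolding acyclic_edge_colouring_iff by blast
qed

text \<open>A colouring of \<open>G'\<close> is pulled back along \<open>\<phi>\<close>; alternating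
  walks are pushed forward. This is what allows the factors of a product to be exchanged.\<close>

lemma acyclic_chromatic_index_mono:
  fixes \<phi> :: "'a \<Rightarrow> 'b"
  assumes "pair_graph G" "pair_graph G'" "inj \<phi>"
    and hom: "\<And>u v. (u, v) \<in> parcs G \<Longrightarrow> (\<phi> u, \<phi> v) \<in> parcs G'"
  shows "acyclic_chromatic_index G \<le> acyclic_chromatic_index G'"
proof -
  interpret G: pair_graph G by fact
  interpret G': pair_graph G' by fact
  obtain c :: "'b set \<Rightarrow> nat" where c: "acyclic_edge_colouring G' c"
    "card (c ` graph_edges G') = acyclic_chromatic_index G'"
    using acyclic_chromatic_index_colouring[OF assms(2)] .
  let ?c = "\<lambda>e. c (\<phi> ` e)"
  have proper: "proper_edge_colouring G' c"
    using c(1) by (simp add: acyclic_edge_colouring_def)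
  have "?c {u, v} \<noteq> ?c {u, w}" if "(u, v) \<in> parcs G" "(u, w) \<in> parcs G" "v \<noteq> w" for u v w
    using proper[unfolded G'.proper_edge_colouring_iff, rule_format, OF hom[OF that(1)] hom[OF that(2)]]
      that(3) \<open>inj \<phi>\<close> by (simp add: inj_eq)
  then have "proper_edge_colouring G ?c"
    unfolding G.proper_edge_colouring_iff by blast
  moreover have "alternating_walk G' c p q (\<phi> \<circ> x)" if "alternating_walk G ?c p q x" for p q x
    using that hom by (auto simp: alternating_walk_def)
  ultimately have "acyclic_edge_colouring G ?c"
    using c(1) unfolding G.acyclic_edge_colouring_iff G'.acyclic_edge_colouring_iff by blast
  moreover have "?c ` graph_edges G \<subseteq> c ` graph_edges G'"
    using hom by (force simp: graph_edges_def)
  then have "card (?c ` graph_edges G) \<le> acyclic_chromatic_index G'"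
    using c(2) G'.finite_graph_edges by (metis card_mono finite_imageI)
  ultimately show ?thesis by (rule acyclic_chromatic_index_le)
qed

section \<open>Greedy vertex colouring and degrees\<close>

text \<open>
  Greedy colouring without an explicit order: a nonempty proper subset \<open>S\<close> of the vertices contains a
  vertex with a neighbour outside \<open>S\<close>, which is coloured last within \<open>S\<close>; finally \<open>w\<close> is coloured.
\<close>

lemma (in pair_graph) proper_vertex_colouring:
  assumes conn: "connected (with_proj G)"
    and deg: "\<And>v. card {u. (v, u) \<in> parcs G} \<le> a"
    and w: "w \<in> pverts G" "card {u. (w, u) \<in> parcs G} < a"
  obtains f where "\<And>v. f v < a" "\<And>u v. (u, v) \<in> parcs G \<Longrightarrow> f u \<noteq> f v"
proof -
  let ?N = "\<lambda>v. {u. (v, u) \<in> parcs G}"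
  let ?col = "\<lambda>S f. (\<forall>v. f v < a) \<and> (\<forall>u\<in>S. \<forall>v\<in>S. (u, v) \<in> parcs G \<longrightarrow> f u \<noteq> f v)"
  have finN: "finite (?N v)" for v
    using in_arcsD2 by (intro finite_subset[OF _ pair_finite_verts]) auto
  \<comment> \<open>Fewer than \<open>a\<close> neighbours in \<open>S\<close> leave a colour free
    for \<open>v\<close>.\<close>
  have step: "\<exists>f. ?col (insert v S) f" if f: "?col S f" and v: "card (?N v \<inter> S) < a" for f S v
  proof -
    have "card (f ` (?N v \<inter> S)) < card {..<a}"
      using v card_image_le[of "?N v \<inter> S" f] finN by (simp add: order_le_less_trans)
    then have "\<not> {..<a} \<subseteq> f ` (?N v \<inter> S)"
      using card_mono[of "f ` (?N v \<inter> S)" "{..<a}"] finN by auto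
    then obtain k where "k < a" "k \<notin> f ` (?N v \<inter> S)" by blast
    then have "?col (insert v S) (f(v := k))"
      using f no_loops' arcs_symmetric by auto
    then show ?thesis by blast
  qed
  \<comment> \<open>A set that no arc leaves contains all that is reachable from it, which by
    connectedness is every vertex.\<close>
  have boundary: "\<exists>u\<in>S. \<exists>v. v \<notin> S \<and> (u, v) \<in> parcs G"
    if S: "S \<subset> pverts G" "S \<noteq> {}" for S
  proof (rule ccontr)
    assume closed: "\<not> ?thesis"
    obtain s t where st: "s \<in> S" "t \<in> pverts G" "t \<notin> S" using S by blast
    have "strongly_connected (with_proj G)"
      using symmetric_connected_imp_strongly_connected[OF sym_arcs conn] .
    then have "s \<rightarrow>\<^sup>*\<^bsub>with_proj G\<^esub> t"
      using st S by (auto simp: strongly_connected_def)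
    then have "t \<in> S"
      by (induction rule: reachable_induct) (use closed st in auto)
    with st show False by blast
  qed
  have sub: "\<exists>f. ?col S f" if "S \<subset> pverts G" for S
  proof -
    have "finite S" using that pair_finite_verts finite_subset by blast
    then show ?thesis using that
    proof (induction S rule: finite_psubset_induct)
      case (psubset S)
      show ?case
      proof (cases "S = {}")
        case True
        \<comment> \<open>The colour 0 is available because the strict bound in \<open>w(2)\<close>
          gives \<open>0 < a\<close>.\<close>
        then show ?thesis using w(2) by (intro exI[of _ "\<lambda>_. 0"]) auto
      next
        case False
        then obtain u v where uv: "u \<in> S" "v \<notin> S" "(u, v) \<in> parcs G"
          using boundary psubset.prems by blast
        obtain f where f: "?col (S - {u}) f"
          using psubset.IH[of "S - {u}"] psubset.prems uv by blast
        \<comment> \<open>The neighbour \<open>v\<close> outside \<open>S\<close> makes the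
          inclusion strict, so even a vertex of degree \<open>a\<close> has fewer than
          \<open>a\<close> coloured neighbours.\<close>
        have "?N u \<inter> (S - {u}) \<subset> ?N u" using uv by blast
        then have "card (?N u \<inter> (S - {u})) < a"
          using deg[of u] psubset_card_mono[OF finN] by (meson order_less_le_trans)
        from step[OF f this] uv(1) show ?thesis by (simp add: insert_absorb)
      qed
    qed
  qed
  obtain f where f: "?col (pverts G - {w}) f" using sub[of "pverts G - {w}"] w by blast
  \<comment> \<open>Here no neighbour is left uncoloured; the smaller degree of \<open>w\<close>
    provides the free colour instead.\<close>
  have "card (?N w \<inter> (pverts G - {w})) < a"
    using w(2) card_mono[OF finN, of "?N w \<inter> (pverts G - {w})" w]
    by (meson inf_le1 order_le_less_trans)
  from step[OF f this] obtain g where "?col (pverts G) g"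
    using w(1) by (auto simp: insert_absorb)
  then show ?thesis using that in_arcsD1 in_arcsD2 by blast
qed

text \<open>Through this injection the degree of \<open>v\<close> counts the colours seen at
  \<open>v\<close>, which bounds degrees by the number of colours.\<close>

lemma (in pair_graph) inj_on_colours_at:
  assumes "proper_edge_colouring G c"
  shows "inj_on (\<lambda>u. c {v, u}) {u. (v, u) \<in> parcs G}"
  using assms unfolding proper_edge_colouring_iff inj_on_def by blast

text \<open>If every vertex saw all colours, one could walk forever along two of them.\<close>

lemma (in pair_graph) ex_degree_less:
  assumes c: "acyclic_edge_colouring G c"
    and a: "card (c ` graph_edges G) \<le> a" "2 \<le> a" and ne: "pverts G \<noteq> {}"
  shows "\<exists>w\<in>pverts G. card {u. (w, u) \<in> parcs G} < a"
proof (rule ccontr)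
  assume "\<not> ?thesis"
  then have deg: "a \<le> card {u. (v, u) \<in> parcs G}" if "v \<in> pverts G" for v
    using that by (meson not_le)
  have proper: "proper_edge_colouring G c" using c by (simp add: acyclic_edge_colouring_def)
  \<comment> \<open>At least \<open>a\<close> different colours are seen at \<open>v\<close>, and at
    most \<open>a\<close> exist.\<close>
  have all: "(\<lambda>u. c {v, u}) ` {u. (v, u) \<in> parcs G} = c ` graph_edges G" if "v \<in> pverts G" for v
  proof (rule card_seteq)
    show "(\<lambda>u. c {v, u}) ` {u. (v, u) \<in> parcs G} \<subseteq> c ` graph_edges G"
      by (auto simp: graph_edges_def)
    show "card (c ` graph_edges G) \<le> card ((\<lambda>u. c {v, u}) ` {u. (v, u) \<in> parcs G})"
      using a deg[OF that] by (simp add: card_image[OF inj_on_colours_at[OF proper]])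
  qed (simp add: finite_graph_edges)
  obtain v0 where v0: "v0 \<in> pverts G" using ne by blast
  have "2 \<le> card (c ` graph_edges G)"
    using all[OF v0] a(2) deg[OF v0] card_image[OF inj_on_colours_at[OF proper], of v0] by simp
  then obtain p q where pq: "p \<in> c ` graph_edges G" "q \<in> c ` graph_edges G" "p \<noteq> q"
    by (metis card_le_Suc0_iff_eq finite_graph_edges finite_imageI not_less_eq_eq numeral_2_eq_2)
  have next_arc: "\<exists>u. (v, u) \<in> parcs G \<and> c {v, u} = r"
    if "v \<in> pverts G" "r \<in> c ` graph_edges G" for v r
    using that(2) unfolding all[OF that(1), symmetric] by auto
  have "\<exists>x. \<forall>i. x i \<in> pverts G \<and>
    ((x i, x (Suc i)) \<in> parcs G \<and> c {x i, x (Suc i)} = (if even i then p else q))"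
  proof (rule dependent_nat_choice)
    show "\<exists>v. v \<in> pverts G" using v0 by blast
    show "\<exists>u. u \<in> pverts G \<and> ((v, u) \<in> parcs G \<and> c {v, u} = (if even i then p else q))"
      if "v \<in> pverts G" for v and i :: nat
      using next_arc[OF that, of "if even i then p else q"] pq in_arcsD2 by (metis (full_types))
  qed
  then show False
    using c pq(3) unfolding acyclic_edge_colouring_iff alternating_walk_def by blast
qed

section \<open>The colouring of the product\<close>

text \<open>An edge of the product lies in a copy of \<open>G\<close> iff its second projection is a single vertex.\<close>

definition product_colouring ::
    "nat \<Rightarrow> ('a set \<Rightarrow> nat) \<Rightarrow> ('b set \<Rightarrow> nat) \<Rightarrow> ('b \<Rightarrow> nat) \<Rightarrow> ('a \<times> 'b) set \<Rightarrow> nat" where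
  "product_colouring a cG cH f e =
    (if is_singleton (snd ` e) then (cG (fst ` e) + f (the_elem (snd ` e))) mod a
     else a + cH (snd ` e))"

lemma product_colouring_simps:
  "product_colouring a cG cH f {(u, v), (u', v)} = (cG {u, u'} + f v) mod a"
  "v \<noteq> v' \<Longrightarrow> product_colouring a cG cH f {(u, v), (u', v')} = a + cH {v, v'}"
  by (auto simp: product_colouring_def is_singleton_def)

text \<open>Colours below \<open>a\<close> mark moves in \<open>G\<close>, the others moves in
  \<open>H\<close>. Two colours of one kind give an alternating walk in that factor. With one of
  each kind, the walk alternates between two copies of \<open>G\<close>, whose different shifts turn
  one colour of the product into two colours of \<open>G\<close>.\<close>

lemma acyclic_product_colouring:
  assumes "pair_graph G" "pair_graph H"
    and cG: "acyclic_edge_colouring G cG" and less: "\<And>e. e \<in> graph_edges G \<Longrightarrow> cG e < a"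
    and cH: "acyclic_edge_colouring H cH"
    and f: "\<And>u v. (u, v) \<in> parcs H \<Longrightarrow> f u \<noteq> f v" "\<And>v. f v < a"
  shows "acyclic_edge_colouring (G \<box> H) (product_colouring a cG cH f)"
proof -
  interpret G: pair_graph G by fact
  interpret H: pair_graph H by fact
  interpret P: pair_graph "G \<box> H" using assms by (simp add: pair_graph_cartesian_product)
  let ?c = "product_colouring a cG cH f"
  have a: "0 < a" using f(2) by (metis gr0I not_less0)
  have lessG: "cG {u, v} < a" if "(u, v) \<in> parcs G" for u v
    using that less by (auto simp: graph_edges_def)
  have arc_cases: "(fst y = fst z \<and> (snd y, snd z) \<in> parcs H \<and> ?c {y, z} = a + cH {snd y, snd z}) \<or>
     (snd y = snd z \<and> (fst y, fst z) \<in> parcs G \<and> cG {fst y, fst z} < a \<and>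
      ?c {y, z} = (cG {fst y, fst z} + f (snd y)) mod a \<and> ?c {y, z} < a)"
    if "(y, z) \<in> parcs (G \<box> H)" for y z
    using that a H.no_loops' lessG
    by (cases y; cases z) (auto simp: cartesian_product_def product_colouring_simps)
  have G_arc: "snd y = snd z \<and> (fst y, fst z) \<in> parcs G \<and> cG {fst y, fst z} < a \<and>
      ?c {y, z} = (cG {fst y, fst z} + f (snd y)) mod a"
    if "(y, z) \<in> parcs (G \<box> H)" "?c {y, z} < a" for y z
    using arc_cases[OF that(1)] that(2) by auto
  have H_arc: "fst y = fst z \<and> (snd y, snd z) \<in> parcs H \<and> ?c {y, z} = a + cH {snd y, snd z}"
    if "(y, z) \<in> parcs (G \<box> H)" "\<not> ?c {y, z} < a" for y z
    using arc_cases[OF that(1)] that(2) by auto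
  \<comment> \<open>Adding a fixed shift is injective modulo \<open>a\<close>; in
    \<open>inj'\<close>, different shifts of one colour give different colours.\<close>
  have inj: "k = l" if "(k + r) mod a = (l + r) mod a" "k < a" "l < a" for k l r
    using that cong_add_rcancel_nat[of k r l a] by (simp add: cong_def)
  have inj': "r = s" if "(k + r) mod a = (k + s) mod a" "r < a" "s < a" for k r s
    using inj[of r k s] that by (simp add: add.commute)
  have properG: "v = w" if "(u, v) \<in> parcs G" "(u, w) \<in> parcs G" "cG {u, v} = cG {u, w}" for u v w
    using cG that unfolding G.acyclic_edge_colouring_iff G.proper_edge_colouring_iff by blast
  have properH: "v = w" if "(u, v) \<in> parcs H" "(u, w) \<in> parcs H" "cH {u, v} = cH {u, w}" for u v w
    using cH that unfolding H.acyclic_edge_colouring_iff H.proper_edge_colouring_iff by blast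
  have "y = z" if yz: "(x, y) \<in> parcs (G \<box> H)" "(x, z) \<in> parcs (G \<box> H)" "?c {x, y} = ?c {x, z}" for x y z
  proof (cases "?c {x, y} < a")
    case True
    then show ?thesis
      using G_arc[OF yz(1)] G_arc[OF yz(2)] yz(3) inj properG by (metis prod_eqI)
  next
    case False
    then show ?thesis
      using H_arc[OF yz(1)] H_arc[OF yz(2)] yz(3) properH by (metis prod_eqI add_left_cancel)
  qed
  then have "proper_edge_colouring (G \<box> H) ?c"
    unfolding P.proper_edge_colouring_iff by blast
  moreover have mixed: False
    if x: "alternating_walk (G \<box> H) ?c p q x" and pq: "p < a" "\<not> q < a" for p q x
  proof -
    have arc: "(x i, x (Suc i)) \<in> parcs (G \<box> H)" for i
      using x by (simp add: alternating_walk_def)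
    have col: "?c {x i, x (Suc i)} = (if even i then p else q)" for i
      using x by (simp add: alternating_walk_def)
    \<comment> \<open>Arcs at odd positions fix the first coordinate, so the first coordinates at
      even positions form a walk \<open>g\<close> in \<open>G\<close>; \<open>h j\<close> names the
      copy of \<open>G\<close> in which its \<open>j\<close>-th arc is traversed.\<close>
    define g where "g j = fst (x (2 * j))" for j
    define h where "h j = snd (x (2 * j))" for j
    have even_arc: "snd (x (Suc (2 * j))) = h j" "(g j, fst (x (Suc (2 * j)))) \<in> parcs G"
      "cG {g j, fst (x (Suc (2 * j)))} < a" "(cG {g j, fst (x (Suc (2 * j)))} + f (h j)) mod a = p"
      for j
      using G_arc[OF arc[of "2 * j"]] col[of "2 * j"] pq by (auto simp: g_def h_def)
    have odd_arc: "fst (x (Suc (2 * j))) = g (Suc j)" "(h j, h (Suc j)) \<in> parcs H"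
      "a + cH {h j, h (Suc j)} = q" for j
      using H_arc[OF arc[of "Suc (2 * j)"]] col[of "Suc (2 * j)"] pq even_arc(1)[of j]
      by (auto simp: g_def h_def)
    \<comment> \<open>All arcs of \<open>h\<close> have the same colour, so properness of
      \<open>cH\<close> forces each one to reverse the one before.\<close>
    have h_back: "h (Suc (Suc j)) = h j" for j
    proof -
      have "cH {h (Suc j), h (Suc (Suc j))} = cH {h (Suc j), h j}"
        using odd_arc(3)[of j] odd_arc(3)[of "Suc j"] by (simp add: insert_commute)
      then show ?thesis
        using properH odd_arc(2)[of j] odd_arc(2)[of "Suc j"] H.arcs_symmetric by blast
    qed
    have h: "h j = (if even j then h 0 else h 1)" for j
      by (induction j rule: induct_nat_012) (auto simp: h_back)
    have g_arc: "(g j, g (Suc j)) \<in> parcs G" "cG {g j, g (Suc j)} < a"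
      "(cG {g j, g (Suc j)} + f (h j)) mod a = p" for j
      using even_arc[of j] odd_arc(1)[of j] by auto
    \<comment> \<open>Within one copy of \<open>G\<close> the shift is fixed, so \<open>p\<close>
      stems from a single colour of \<open>G\<close>.\<close>
    have same: "cG {g i, g (Suc i)} = cG {g j, g (Suc j)}" if "h i = h j" for i j
      using g_arc(2,3)[of i] g_arc(2,3)[of j] that
        inj[of "cG {g i, g (Suc i)}" "f (h j)" "cG {g j, g (Suc j)}"] by simp
    have "cG {g j, g (Suc j)} = (if even j then cG {g 0, g 1} else cG {g 1, g 2})" for j
      using same[of j 0] same[of j 1] h[of j] by (simp add: numeral_2_eq_2)
    then have "alternating_walk G cG (cG {g 0, g 1}) (cG {g 1, g 2}) g"
      using g_arc(1) unfolding alternating_walk_def by blast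
    \<comment> \<open>Equal colours with the same shifted value \<open>p\<close> would give
      \<open>f (h 0) = f (h 1)\<close>, although \<open>h 0\<close> and \<open>h 1\<close> are
      adjacent.\<close>
    moreover have "cG {g 0, g 1} \<noteq> cG {g 1, g 2}"
      using g_arc(3)[of 0] g_arc(3)[of 1] f(1)[OF odd_arc(2)[of 0]] f(2)
        inj'[of "cG {g 0, g 1}" "f (h 0)" "f (h 1)"]
      by (auto simp: numeral_2_eq_2)
    ultimately show False
      using cG unfolding G.acyclic_edge_colouring_iff by blast
  qed
  moreover have False if pq: "p \<noteq> q" and x: "alternating_walk (G \<box> H) ?c p q x" for p q x
  proof -
    have arc: "(x i, x (Suc i)) \<in> parcs (G \<box> H)" for i
      using x by (simp add: alternating_walk_def)
    have col: "?c {x i, x (Suc i)} = (if even i then p else q)" for i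
      using x by (simp add: alternating_walk_def)
    consider "p < a" "q < a" | "\<not> p < a" "\<not> q < a" | "p < a" "\<not> q < a" | "\<not> p < a" "q < a"
      by blast
    then show False
    proof cases
      case 1
      have all: "snd (x i) = snd (x (Suc i))" "(fst (x i), fst (x (Suc i))) \<in> parcs G"
        "cG {fst (x i), fst (x (Suc i))} < a"
        "(cG {fst (x i), fst (x (Suc i))} + f (snd (x i))) mod a = (if even i then p else q)" for i
        using G_arc[OF arc[of i]] col[of i] 1 by auto
      \<comment> \<open>The walk never leaves one copy of \<open>G\<close>, so a single shift
        applies throughout.\<close>
      have snd: "snd (x i) = snd (x 0)" for i
        by (induction i) (use all(1) in auto)
      let ?d = "\<lambda>i. cG {fst (x i), fst (x (Suc i))}"
      have same: "?d i = ?d j" if "even i = even j" for i j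
        using all(3,4)[of i] all(3,4)[of j] snd[of i] snd[of j] that
          inj[of "?d i" "f (snd (x 0))" "?d j"] by simp
      have "?d i = (if even i then ?d 0 else ?d 1)" for i
        using same[of i 0] same[of i 1] by simp
      then have "alternating_walk G cG (?d 0) (?d 1) (\<lambda>i. fst (x i))"
        using all(2) unfolding alternating_walk_def by blast
      moreover have "?d 0 \<noteq> ?d 1"
        using all(4)[of 0] all(4)[of 1] pq snd[of 1] by auto
      ultimately show False using cG unfolding G.acyclic_edge_colouring_iff by blast
    next
      case 2
      have "(snd (x i), snd (x (Suc i))) \<in> parcs H \<and>
        cH {snd (x i), snd (x (Suc i))} = (if even i then p - a else q - a)" for i
        using H_arc[OF arc[of i]] col[of i] 2 by auto
      then have "alternating_walk H cH (p - a) (q - a) (\<lambda>i. snd (x i))"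
        unfolding alternating_walk_def by blast
      moreover have "p - a \<noteq> q - a" using 2 pq by auto
      ultimately show False using cH unfolding H.acyclic_edge_colouring_iff by blast
    next
      case 3
      then show False using mixed x by blast
    next
      \<comment> \<open>Dropping the first vertex exchanges the roles of \<open>p\<close> and
        \<open>q\<close>.\<close>
      case 4
      then show False using mixed alternating_walk_shift[OF x] by blast
    qed
  qed
  ultimately show ?thesis unfolding P.acyclic_edge_colouring_iff by blast
qed

section \<open>Counting colours and the bound\<close>

text \<open>Reduction modulo \<open>a\<close> keeps all shifted copies of \<open>G\<close> within
  the same \<open>a\<close> colours, and all copies of \<open>H\<close> share the translated colours
  of \<open>cH\<close>; hence the number of colours is bounded by a sum.\<close>

lemma product_colouring_image:
  assumes "0 < a" "pair_graph H"
  shows "product_colouring a cG cH f ` graph_edges (G \<box> H) \<subseteq> {..<a} \<union> (+) a ` cH ` graph_edges H"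
proof -
  interpret H: pair_graph H by fact
  show ?thesis
  proof
    fix k assume "k \<in> product_colouring a cG cH f ` graph_edges (G \<box> H)"
    then obtain u v u' v' where k: "k = product_colouring a cG cH f {(u, v), (u', v')}"
      and "((u, v), (u', v')) \<in> parcs (G \<box> H)"
      by (auto simp: graph_edges_def)
    then consider "v = v'" | "v \<noteq> v'" "(v, v') \<in> parcs H"
      using H.no_loops' by (auto simp: cartesian_product_def)
    then show "k \<in> {..<a} \<union> (+) a ` cH ` graph_edges H"
      by cases (use assms(1) in \<open>auto simp: k product_colouring_simps graph_edges_def\<close>)
  qed
qed

text \<open>The factor with the larger index is the one to shift: degrees in \<open>H\<close> are at
  most the index of \<open>H\<close>, so the \<open>a\<close> available shifts suffice for a proper
  vertex colouring of \<open>H\<close>.\<close>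

lemma acyclic_chromatic_index_product_le:
  fixes G :: "'a pair_pre_digraph" and H :: "'b pair_pre_digraph"
  assumes "pair_graph G" "pair_graph H" "connected (with_proj H)" "pverts H \<noteq> {}"
    and le: "acyclic_chromatic_index H \<le> acyclic_chromatic_index G"
    and two: "2 \<le> acyclic_chromatic_index G"
  shows "acyclic_chromatic_index (G \<box> H) \<le> acyclic_chromatic_index G + acyclic_chromatic_index H"
proof -
  interpret G: pair_graph G by fact
  interpret H: pair_graph H by fact
  define a where "a = acyclic_chromatic_index G"
  obtain c :: "'a set \<Rightarrow> nat" where c: "acyclic_edge_colouring G c" "card (c ` graph_edges G) = a"
    using acyclic_chromatic_index_colouring[OF assms(1)] a_def by metis
  obtain cH :: "'b set \<Rightarrow> nat" where cH: "acyclic_edge_colouring H cH"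
    "card (cH ` graph_edges H) = acyclic_chromatic_index H"
    using acyclic_chromatic_index_colouring[OF assms(2)] .
  \<comment> \<open>On the colours \<open>0, ..., a - 1\<close> each shift modulo \<open>a\<close>
    acts as a permutation.\<close>
  obtain g where g: "bij_betw g (c ` graph_edges G) {..<a}"
    using c(2) finite_same_card_bij[of "c ` graph_edges G" "{..<a}"] G.finite_graph_edges by auto
  have cG: "acyclic_edge_colouring G (g \<circ> c)"
    using G.acyclic_edge_colouring_comp[OF c(1)] g by (auto simp: bij_betw_def)
  have less: "(g \<circ> c) e < a" if "e \<in> graph_edges G" for e
    using g that by (auto simp: bij_betw_def)
  have deg: "card {u. (v, u) \<in> parcs H} \<le> a" for v
  proof -
    have "inj_on (\<lambda>u. cH {v, u}) {u. (v, u) \<in> parcs H}"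
      using H.inj_on_colours_at cH(1) by (auto simp: acyclic_edge_colouring_def)
    moreover have "(\<lambda>u. cH {v, u}) ` {u. (v, u) \<in> parcs H} \<subseteq> cH ` graph_edges H"
      by (auto simp: graph_edges_def)
    ultimately have "card {u. (v, u) \<in> parcs H} \<le> card (cH ` graph_edges H)"
      by (rule card_inj_on_le) (simp add: H.finite_graph_edges)
    then show ?thesis using cH(2) le a_def by simp
  qed
  obtain w where w: "w \<in> pverts H" "card {u. (w, u) \<in> parcs H} < a"
    using H.ex_degree_less[OF cH(1), of a] cH(2) le two assms(4) a_def by auto
  obtain f where f: "\<And>v. f v < a" "\<And>u v. (u, v) \<in> parcs H \<Longrightarrow> f u \<noteq> f v"
    using H.proper_vertex_colouring[OF assms(3) deg w] by blast
  let ?c = "product_colouring a (g \<circ> c) cH f"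
  have "acyclic_edge_colouring (G \<box> H) ?c"
    using acyclic_product_colouring[OF assms(1,2) cG less cH(1) f(2,1)] .
  moreover have "card (?c ` graph_edges (G \<box> H)) \<le> a + acyclic_chromatic_index H"
  proof -
    have "card (?c ` graph_edges (G \<box> H)) \<le> card ({..<a} \<union> (+) a ` cH ` graph_edges H)"
      by (rule card_mono[OF _ product_colouring_image])
         (use two a_def H.finite_graph_edges assms(2) in auto)
    also have "\<dots> \<le> card {..<a} + card ((+) a ` cH ` graph_edges H)"
      by (rule card_Un_le)
    also have "\<dots> = a + acyclic_chromatic_index H"
      using cH(2) by (simp add: card_image)
    finally show ?thesis .
  qed
  ultimately show ?thesis
    unfolding a_def by (rule acyclic_chromatic_index_le)
qed

theorem theorem2p1:
  fixes G :: "'a pair_pre_digraph" and H :: "'b pair_pre_digraph"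
  assumes "pair_graph G" and "pair_graph H"
    and "connected (with_proj G)" and "connected (with_proj H)"
    and "card (pverts G) \<ge> 2" and "card (pverts H) \<ge> 2"
    and "max (acyclic_chromatic_index G) (acyclic_chromatic_index H) > 1"
  shows "acyclic_chromatic_index (G \<box> H) \<le> acyclic_chromatic_index G + acyclic_chromatic_index H"
proof (cases "acyclic_chromatic_index H \<le> acyclic_chromatic_index G")
  case True
  have "pverts H \<noteq> {}" using assms(6) by auto
  with True assms show ?thesis
    by (intro acyclic_chromatic_index_product_le) auto
next
  case False
  \<comment> \<open>Swapping coordinates embeds \<open>G \<box> H\<close> into
    \<open>H \<box> G\<close>, which puts the factor with the larger index first.\<close>
  have "acyclic_chromatic_index (G \<box> H) \<le> acyclic_chromatic_index (H \<box> G)"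
    using assms(1,2)
    by (intro acyclic_chromatic_index_mono[where \<phi> = prod.swap] pair_graph_cartesian_product)
       (auto simp: cartesian_product_def)
  also have "pverts G \<noteq> {}" using assms(5) by auto
  with False assms have "acyclic_chromatic_index (H \<box> G) \<le>
      acyclic_chromatic_index H + acyclic_chromatic_index G"
    by (intro acyclic_chromatic_index_product_le) auto
  finally show ?thesis by simp
qed

end
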